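(* Let $(\mathbf M,\rhd)$ be a diagonal left-regular magma, let $F_{\mathbf M}$ be the free group generated by the set $\mathbf M$, with multiplication denoted by a lower dot $.$, and let $\iota:\mathbf M\to F_{\mathbf M}$ be the canonical inclusion. Then there is a unique way to extend the binary product $\rhd:\mathbf M\times\mathbf M\to\mathbf M$ to a binary product $\rhd:F_{\mathbf M}\times F_{\mathbf M}\to F_{\mathbf M}$ such that $(F_{\mathbf M},.,\rhd)$ is a post-group. Moreover, the post-group $F_{\mathbf M}$ thus obtained satisfies the following universal property (making it the free post-group generated by the magma $\mathbf M$): for any post-group $(G,.,\rhd)$ and for any magma morphism $\varphi:\mathbf M\to (G,\rhd)$, there is a unique post-group morphism $\Phi:F_{\mathbf M}\to G$ such that $\Phi\circ\iota=\varphi$.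
   Context: A magma is a set $\mathbf M$ with a binary product $\rhd:\mathbf M\times\mathbf M\to\mathbf M$; a magma morphism is a map respecting the products $\rhd$. A magma is left-regular if for every $m\in\mathbf M$ the left multiplication $L_m^\rhd=m\rhd -:\mathbf M\to\mathbf M$ is bijective. A left-regular magma is diagonal if moreover the map $\Lambda:\mathbf M\to\mathbf M$, $\Lambda(m)=(L_m^\rhd)^{-1}(m)$, is a bijection. A post-group $(G,.,\rhd)$ is a group $(G,.)$ endowed with a binary map $\rhd:G\times G\to G$ such that for every $a\in G$ the map $L_a^\rhd:=a\rhd -:G\to G$ is a group automorphism of $(G,.)$, and such that $(a*b)\rhd c=a\rhd(b\rhd c)$ for all $a,b,c\in G$, where $a*b:=a.(a\rhd b)$. A morphism of post-groups is a group morphism (for the products $.$) that also respects the products $\rhd$. *)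

theory Defs
  imports "HOL-Algebra.Group"
begin

section \<open>Left-regular and diagonal magmas\<close>

text \<open>The carrier is an explicit set, so that the empty magma is allowed.\<close>

locale magma =
  fixes M :: "'a set" and op :: "'a \<Rightarrow> 'a \<Rightarrow> 'a" (infixl "\<rhd>" 70)
  assumes op_closed: "\<lbrakk>a \<in> M; b \<in> M\<rbrakk> \<Longrightarrow> a \<rhd> b \<in> M"

locale left_regular_magma = magma +
  assumes left_regular: "a \<in> M \<Longrightarrow> bij_betw (\<lambda>b. a \<rhd> b) M M"

definition magma_Lambda :: "'a set \<Rightarrow> ('a \<Rightarrow> 'a \<Rightarrow> 'a) \<Rightarrow> 'a \<Rightarrow> 'a" where
  "magma_Lambda M op m = inv_into M (op m) m"

locale diagonal_left_regular_magma = left_regular_magma +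
  assumes diagonal: "bij_betw (magma_Lambda M op) M M"

definition magma_hom ::
  "'a set \<Rightarrow> ('a \<Rightarrow> 'a \<Rightarrow> 'a) \<Rightarrow> 'b set \<Rightarrow> ('b \<Rightarrow> 'b \<Rightarrow> 'b) \<Rightarrow> ('a \<Rightarrow> 'b) set" where
  "magma_hom M op N op' =
     {f. f \<in> M \<rightarrow> N \<and> (\<forall>a\<in>M. \<forall>b\<in>M. f (op a b) = op' (f a) (f b))}"


section \<open>Post-groups\<close>

locale post_group = group G for G (structure) +
  fixes post :: "'a \<Rightarrow> 'a \<Rightarrow> 'a" (infixl "\<rhd>" 75)
  assumes post_aut: "a \<in> carrier G \<Longrightarrow> (\<lambda>b. a \<rhd> b) \<in> iso G G"
    and post_mult: "\<lbrakk>a \<in> carrier G; b \<in> carrier G; c \<in> carrier G\<rbrakk> \<Longrightarrow>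
      (a \<otimes> (a \<rhd> b)) \<rhd> c = a \<rhd> (b \<rhd> c)"

definition post_group_hom ::
  "('a, 'x) monoid_scheme \<Rightarrow> ('a \<Rightarrow> 'a \<Rightarrow> 'a) \<Rightarrow>
   ('b, 'y) monoid_scheme \<Rightarrow> ('b \<Rightarrow> 'b \<Rightarrow> 'b) \<Rightarrow> ('a \<Rightarrow> 'b) set" where
  "post_group_hom G p H q =
     {f. f \<in> hom G H \<and> (\<forall>a\<in>carrier G. \<forall>b\<in>carrier G. f (p a b) = q (f a) (f b))}"


section \<open>The free group on a set\<close>

text \<open>
  Elements are reduced words in letters \<open>(x, e)\<close>: the letter is the generator \<open>x\<close>
  if \<open>e\<close> holds, and its formal inverse otherwise.
\<close>

fun reduced :: "('a \<times> bool) list \<Rightarrow> bool" where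
  "reduced (l # k # w) \<longleftrightarrow> \<not> (fst l = fst k \<and> snd l \<noteq> snd k) \<and> reduced (k # w)"
| "reduced _ \<longleftrightarrow> True"

fun cons_reduce :: "'a \<times> bool \<Rightarrow> ('a \<times> bool) list \<Rightarrow> ('a \<times> bool) list" where
  "cons_reduce l [] = [l]"
| "cons_reduce l (k # w) = (if fst l = fst k \<and> snd l \<noteq> snd k then w else l # k # w)"

definition free_group :: "'a set \<Rightarrow> ('a \<times> bool) list monoid" where
  "free_group X =
     \<lparr>carrier = {w. reduced w \<and> fst ` set w \<subseteq> X},
      monoid.mult = (\<lambda>u v. foldr cons_reduce u v),
      one = []\<rparr>"

definition free_incl :: "'a \<Rightarrow> ('a \<times> bool) list" where
  "free_incl x = [(x, True)]"

text \<open>Well-definedness of the construction: it is a group with the usual universal property.\<close>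

lemma reduced_tl: "reduced (l # w) \<Longrightarrow> reduced w"
  by (cases w) auto

lemma reduced_cons_reduce: "reduced w \<Longrightarrow> reduced (cons_reduce l w)"
  by (cases w) (auto dest: reduced_tl)

lemma reduced_foldr_cons_reduce: "reduced v \<Longrightarrow> reduced (foldr cons_reduce u v)"
  by (induction u) (auto intro: reduced_cons_reduce)

lemma set_foldr_cons_reduce: "set (foldr cons_reduce u v) \<subseteq> set u \<union> set v"
proof -
  have cons: "set (cons_reduce l w) \<subseteq> insert l (set w)" for l :: "'a \<times> bool" and w
    by (cases w) auto
  show ?thesis
    by (induction u) (use cons in fastforce)+
qed

lemma foldr_cons_reduce_Nil: "reduced u \<Longrightarrow> foldr cons_reduce u [] = u"
proof (induction u)
  case (Cons l u)
  then show ?case by (cases u) auto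
qed simp

lemma cons_reduce_cancel:
  "reduced w \<Longrightarrow> cons_reduce (x, e) (cons_reduce (x, \<not> e) w) = w"
proof (cases w)
  case (Cons k v)
  moreover assume "reduced w"
  ultimately show ?thesis by (cases v; cases k) auto
qed simp

lemma foldr_cons_reduce_cons_reduce:
  assumes "reduced w"
  shows "foldr cons_reduce (cons_reduce l v) w = cons_reduce l (foldr cons_reduce v w)"
proof (cases v)
  case (Cons k v')
  show ?thesis
  proof (cases "fst l = fst k \<and> snd l \<noteq> snd k")
    case True
    obtain x e where l: "l = (x, e)" by (cases l)
    with True have k: "k = (x, \<not> e)" by (cases k) auto
    show ?thesis
      using cons_reduce_cancel[OF reduced_foldr_cons_reduce[OF assms], of x e v']
      by (simp add: Cons l k)
  qed (use Cons in auto)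
qed simp

lemma foldr_cons_reduce_assoc:
  "reduced w \<Longrightarrow> foldr cons_reduce (foldr cons_reduce u v) w =
     foldr cons_reduce u (foldr cons_reduce v w)"
  by (induction u) (auto simp: foldr_cons_reduce_cons_reduce)

lemma foldr_cons_reduce_inverse:
  "reduced v \<Longrightarrow>
     foldr cons_reduce (rev (map (map_prod id Not) u)) (foldr cons_reduce u v) = v"
proof (induction u)
  case (Cons l u)
  then show ?case
    using cons_reduce_cancel[OF reduced_foldr_cons_reduce[OF Cons.prems], of "fst l" "\<not> snd l" u]
    by (auto simp: map_prod_def split_beta)
qed simp

lemma group_free_group: "group (free_group X)"
proof (rule groupI)
  fix u v assume "u \<in> carrier (free_group X)" "v \<in> carrier (free_group X)"
  then show "u \<otimes>\<^bsub>free_group X\<^esub> v \<in> carrier (free_group X)"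
    using set_foldr_cons_reduce[of u v]
    by (fastforce simp: free_group_def intro: reduced_foldr_cons_reduce)
next
  fix u assume u: "u \<in> carrier (free_group X)"
  define i where "i = foldr cons_reduce (rev (map (map_prod id Not) u)) []"
  have "set i \<subseteq> map_prod id Not ` set u"
    unfolding i_def using set_foldr_cons_reduce[of "rev (map (map_prod id Not) u)" "[]"] by simp
  then have "i \<in> carrier (free_group X)"
    using u reduced_foldr_cons_reduce[of "[]"] by (fastforce simp: i_def free_group_def)
  moreover have "i \<otimes>\<^bsub>free_group X\<^esub> u = \<one>\<^bsub>free_group X\<^esub>"
    using u foldr_cons_reduce_inverse[of "[]" u]
    by (simp add: i_def free_group_def foldr_cons_reduce_assoc foldr_cons_reduce_Nil)
  ultimately show "\<exists>v\<in>carrier (free_group X). v \<otimes>\<^bsub>free_group X\<^esub> u = \<one>\<^bsub>free_group X\<^esub>"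
    by blast
qed (auto simp: free_group_def foldr_cons_reduce_assoc)

definition letter_value :: "('b, 'y) monoid_scheme \<Rightarrow> ('a \<Rightarrow> 'b) \<Rightarrow> 'a \<times> bool \<Rightarrow> 'b" where
  "letter_value G f l = (if snd l then f (fst l) else inv\<^bsub>G\<^esub> f (fst l))"

definition word_value :: "('b, 'y) monoid_scheme \<Rightarrow> ('a \<Rightarrow> 'b) \<Rightarrow> ('a \<times> bool) list \<Rightarrow> 'b" where
  "word_value G f w = foldr (\<lambda>l g. letter_value G f l \<otimes>\<^bsub>G\<^esub> g) w \<one>\<^bsub>G\<^esub>"

context group
begin

lemma letter_value_closed:
  "f \<in> X \<rightarrow> carrier G \<Longrightarrow> fst l \<in> X \<Longrightarrow> letter_value G f l \<in> carrier G"
  by (auto simp: letter_value_def)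

lemma word_value_closed:
  "f \<in> X \<rightarrow> carrier G \<Longrightarrow> fst ` set w \<subseteq> X \<Longrightarrow> word_value G f w \<in> carrier G"
  by (induction w) (auto simp: word_value_def intro!: letter_value_closed)

lemma word_value_cons_reduce:
  assumes f: "f \<in> X \<rightarrow> carrier G" and l: "fst l \<in> X" and w: "fst ` set w \<subseteq> X"
  shows "word_value G f (cons_reduce l w) = letter_value G f l \<otimes> word_value G f w"
proof (cases w)
  case (Cons k v)
  show ?thesis
  proof (cases "fst l = fst k \<and> snd l \<noteq> snd k")
    case True
    have "letter_value G f l \<otimes> letter_value G f k = \<one>"
      using True funcset_mem[OF f l] by (auto simp: letter_value_def)
    moreover have "letter_value G f l \<in> carrier G" "letter_value G f k \<in> carrier G"
      "word_value G f v \<in> carrier G"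
      using f l w Cons True
      by (auto intro!: letter_value_closed[OF f] word_value_closed[OF f])
    ultimately have "letter_value G f l \<otimes> (letter_value G f k \<otimes> word_value G f v) = word_value G f v"
      by (simp flip: m_assoc)
    with True Cons show ?thesis by (simp add: word_value_def)
  qed (use Cons in \<open>auto simp: word_value_def\<close>)
qed (simp add: word_value_def)

lemma word_value_mult:
  assumes f: "f \<in> X \<rightarrow> carrier G" and "fst ` set u \<subseteq> X" and v: "fst ` set v \<subseteq> X"
  shows "word_value G f (foldr cons_reduce u v) = word_value G f u \<otimes> word_value G f v"
  using assms(2)
proof (induction u)
  case Nil
  show ?case using word_value_closed[OF f v] by (simp add: word_value_def)
next
  case (Cons l u)
  have "fst ` set (foldr cons_reduce u v) \<subseteq> X"
    using Cons.prems v set_foldr_cons_reduce[of u v] by fastforce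
  moreover have "word_value G f (l # u) = letter_value G f l \<otimes> word_value G f u"
    by (simp add: word_value_def)
  ultimately show ?case
    using Cons v f word_value_cons_reduce[OF f]
    by (simp add: m_assoc letter_value_closed[OF f] word_value_closed[OF f])
qed

end

lemma free_incl_closed: "x \<in> X \<Longrightarrow> free_incl x \<in> carrier (free_group X)"
  by (simp add: free_incl_def free_group_def)

theorem free_group_universal:
  assumes "group G" and f: "f \<in> X \<rightarrow> carrier G"
  shows "\<exists>!h. h \<in> hom (free_group X) G \<and> h \<in> extensional (carrier (free_group X)) \<and>
    (\<forall>x\<in>X. h (free_incl x) = f x)"
proof -
  interpret G: group G by fact
  interpret F: group "free_group X" by (rule group_free_group)
  let ?h = "restrict (word_value G f) (carrier (free_group X))"
  show ?thesis
  proof (rule ex1I[of _ ?h], intro conjI)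
    show "?h \<in> hom (free_group X) G"
    proof (rule homI)
      fix u v assume uv: "u \<in> carrier (free_group X)" "v \<in> carrier (free_group X)"
      then show "?h (u \<otimes>\<^bsub>free_group X\<^esub> v) = ?h u \<otimes>\<^bsub>G\<^esub> ?h v"
        using F.m_closed[OF uv] G.word_value_mult[OF f] by (simp add: free_group_def)
    qed (auto simp: free_group_def intro: G.word_value_closed[OF f])
    show "\<forall>x\<in>X. ?h (free_incl x) = f x"
      using funcset_mem[OF f]
      by (simp add: free_incl_closed) (simp add: free_incl_def word_value_def letter_value_def)
  next
    fix h assume h: "h \<in> hom (free_group X) G \<and> h \<in> extensional (carrier (free_group X)) \<and>
      (\<forall>x\<in>X. h (free_incl x) = f x)"
    then interpret h: group_hom "free_group X" G h
      by unfold_locales auto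
    have letter: "h [l] = letter_value G f l" if "fst l \<in> X" for l
    proof (cases "snd l")
      case True
      then show ?thesis using h that
        by (cases l) (auto simp: free_incl_def letter_value_def)
    next
      case False
      have "[l] \<otimes>\<^bsub>free_group X\<^esub> free_incl (fst l) = \<one>\<^bsub>free_group X\<^esub>"
        using False by (simp add: free_group_def free_incl_def)
      moreover have "[l] \<in> carrier (free_group X)" using that by (simp add: free_group_def)
      ultimately have "[l] = inv\<^bsub>free_group X\<^esub> free_incl (fst l)"
        using that by (simp add: F.inv_equality free_incl_closed)
      then show ?thesis using False h that
        by (simp add: letter_value_def free_incl_closed)
    qed
    have "h w = word_value G f w" if "w \<in> carrier (free_group X)" for w
      using that
    proof (induction w)
      case Nil
      then show ?case using h.hom_one by (simp add: word_value_def free_group_def)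
    next
      case (Cons l w)
      then have w: "w \<in> carrier (free_group X)" and l: "[l] \<in> carrier (free_group X)"
        by (auto simp: free_group_def dest: reduced_tl)
      have "l # w = [l] \<otimes>\<^bsub>free_group X\<^esub> w"
        using Cons.prems by (cases w) (auto simp: free_group_def)
      then have "h (l # w) = h [l] \<otimes>\<^bsub>G\<^esub> h w"
        using w l by simp
      then show ?case
        using Cons.IH[OF w] letter l by (simp add: word_value_def free_group_def)
    qed
    then show "h = ?h"
      using h by (intro extensionalityI[of _ "carrier (free_group X)"]) auto
  qed auto
qed


section \<open>Extending a magma to a post-group on its free group\<close>

text \<open>
  Products on the free group, and morphisms out of it, are taken extensional, so that uniqueness
  means uniqueness on the carrier.
\<close>

definition post_group_extension ::
  "'a set \<Rightarrow> ('a \<Rightarrow> 'a \<Rightarrow> 'a) \<Rightarrow>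
   (('a \<times> bool) list \<Rightarrow> ('a \<times> bool) list \<Rightarrow> ('a \<times> bool) list) \<Rightarrow> bool" where
  "post_group_extension M op p \<longleftrightarrow>
     p \<in> carrier (free_group M) \<rightarrow>\<^sub>E carrier (free_group M) \<rightarrow>\<^sub>E carrier (free_group M) \<and>
     (\<forall>a\<in>M. \<forall>b\<in>M. p (free_incl a) (free_incl b) = free_incl (op a b)) \<and>
     post_group (free_group M) p"

end

theory Submission
  imports Defs
begin

text \<open>
  In a post-group extending \<open>M\<close>, a generator \<open>y\<close> acts on the free group by the permutation
  \<open>L\<^sub>y\<close> of the generators. Since \<open>y \<rhd> \<Lambda>(y) = y\<close>, the \<open>*\<close>-inverse of \<open>y\<close> is the formal inverse
  of \<open>\<Lambda>(y)\<close>; as \<open>\<Lambda>\<close> is bijective, the action of every formal inverse is therefore forced, too.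
  The identity \<open>l . u = l * (L\<^sub>l\<inverse> u)\<close>, in which the permutation \<open>L\<^sub>l\<inverse>\<close> preserves the length of \<open>u\<close>,
  then determines the action of all words by recursion on the length, and shows by induction on
  the length that a group morphism out of the free group respects \<open>\<rhd>\<close> as soon as it does so on
  generators. Uniqueness of the extension is the case of the identity map between the free group
  with the constructed product and the free group with any other extension.
\<close>

section \<open>Relabelling words\<close>

definition relabel :: "('a \<Rightarrow> 'b) \<Rightarrow> ('a \<times> bool) list \<Rightarrow> ('b \<times> bool) list" where
  "relabel f = map (map_prod f id)"

lemma relabel_Nil [simp]: "relabel f [] = []"
  and relabel_Cons [simp]: "relabel f (l # w) = (f (fst l), snd l) # relabel f w"
  by (auto simp: relabel_def map_prod_def split_beta)

lemma length_relabel [simp]: "length (relabel f w) = length w"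
  by (simp add: relabel_def)

lemma relabel_relabel: "relabel f (relabel g w) = relabel (f \<circ> g) w"
  by (simp add: relabel_def map_prod.comp)

lemma relabel_id: "relabel id w = w"
  by (simp add: relabel_def map_prod.id)

lemma fst_set_relabel: "fst ` set (relabel f w) = f ` fst ` set w"
  by (induction w) auto

text \<open>Two letters cancel after an injective relabelling exactly when they cancel before it, so
  relabelling also commutes with reduction.\<close>

lemma reduced_relabel: "inj f \<Longrightarrow> reduced (relabel f w) \<longleftrightarrow> reduced w"
  by (induction w rule: reduced.induct) (auto simp: inj_eq)

lemma relabel_cons_reduce:
  "inj f \<Longrightarrow> relabel f (cons_reduce l w) = cons_reduce (f (fst l), snd l) (relabel f w)"
  by (cases w) (auto simp: inj_eq)

lemma relabel_foldr_cons_reduce: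
  "inj f \<Longrightarrow> relabel f (foldr cons_reduce u v) = foldr cons_reduce (relabel f u) (relabel f v)"
  by (induction u) (auto simp: relabel_cons_reduce)

lemma relabel_closed:
  assumes "inj f" "f ` M \<subseteq> M" "w \<in> carrier (free_group M)"
  shows "relabel f w \<in> carrier (free_group M)"
  using assms by (fastforce simp: free_group_def reduced_relabel fst_set_relabel)

lemma relabel_iso:
  assumes f: "bij f" and fM: "f ` M = M"
  shows "relabel f \<in> iso (free_group M) (free_group M)"
proof -
  let ?g = "Hilbert_Choice.inv f"
  have g: "bij ?g" "?g ` M = M"
    using f image_inv_f_f[OF bij_is_inj[OF f], of M] by (simp_all add: bij_imp_bij_inv fM)
  have "bij_betw (relabel f) (carrier (free_group M)) (carrier (free_group M))"
  proof (rule bij_betwI[where g = "relabel ?g"])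
    show "relabel f \<in> carrier (free_group M) \<rightarrow> carrier (free_group M)"
      using f fM by (auto intro!: relabel_closed simp: bij_is_inj)
    show "relabel ?g \<in> carrier (free_group M) \<rightarrow> carrier (free_group M)"
      using g by (auto intro!: relabel_closed simp: bij_is_inj)
    show "relabel ?g (relabel f w) = w" "relabel f (relabel ?g w) = w" for w
      using f by (simp_all add: relabel_relabel relabel_id bij_is_inj bij_is_surj surj_iff[THEN iffD1])
  qed
  moreover have "relabel f \<in> hom (free_group M) (free_group M)"
    using f fM by (intro homI relabel_closed)
      (auto simp: bij_is_inj free_group_def relabel_foldr_cons_reduce)
  ultimately show ?thesis
    by (simp add: iso_def)
qed


section \<open>Homomorphisms and post-groups\<close>

text \<open>Uniqueness in \<open>free_group_universal\<close> concerns extensional maps, so it is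
  applied to the restrictions to the carrier.\<close>

lemma free_group_hom_eqI:
  assumes "group G" and h: "h \<in> hom (free_group X) G" and k: "k \<in> hom (free_group X) G"
    and eq: "\<And>x. x \<in> X \<Longrightarrow> h (free_incl x) = k (free_incl x)"
    and w: "w \<in> carrier (free_group X)"
  shows "h w = k w"
proof -
  interpret F: group "free_group X" by (rule group_free_group)
  let ?C = "carrier (free_group X)"
  have f: "(\<lambda>x. k (free_incl x)) \<in> X \<rightarrow> carrier G"
    using k by (auto simp: hom_def Pi_iff free_incl_closed)
  have "restrict h ?C \<in> hom (free_group X) G" "restrict k ?C \<in> hom (free_group X) G"
    using h k by (auto simp: hom_def Pi_iff)
  moreover have "\<forall>x\<in>X. restrict h ?C (free_incl x) = k (free_incl x)"
    "\<forall>x\<in>X. restrict k ?C (free_incl x) = k (free_incl x)"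
    by (simp_all add: eq free_incl_closed)
  ultimately have "restrict h ?C = restrict k ?C"
    using free_group_universal[OF \<open>group G\<close> f] restrict_extensional[of _ ?C] by blast
  then show ?thesis
    using w by (metis restrict_apply')
qed

lemma (in post_group) post_closed:
  "\<lbrakk>a \<in> carrier G; b \<in> carrier G\<rbrakk> \<Longrightarrow> a \<rhd> b \<in> carrier G"
  using post_aut by (fastforce simp: iso_def hom_def)

lemma (in post_group) post_inj:
  "\<lbrakk>a \<in> carrier G; b \<in> carrier G; c \<in> carrier G; a \<rhd> b = a \<rhd> c\<rbrakk> \<Longrightarrow> b = c"
  using post_aut[of a] by (auto simp: iso_def bij_betw_def dest: inj_onD)

lemma (in post_group) post_hom: "a \<in> carrier G \<Longrightarrow> (\<rhd>) a \<in> hom G G"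
  using post_aut[of a] by (simp add: iso_def)

lemma (in post_group) post_one_right: "a \<in> carrier G \<Longrightarrow> a \<rhd> \<one> = \<one>"
  using hom_one[OF post_hom] is_group by simp

text \<open>By \<open>post_mult\<close>,
  \<open>\<one> \<rhd> (\<one> \<rhd> b) = \<one> \<rhd> b\<close>, and left multiplication by
  \<open>\<one>\<close> is injective.\<close>

lemma (in post_group) post_one_left:
  assumes "b \<in> carrier G"
  shows "\<one> \<rhd> b = b"
  by (rule post_inj[of \<one>])
    (use post_mult[of \<one> \<one> b] assms in \<open>simp_all add: post_one_right post_closed\<close>)


section \<open>The post-group structure on the free group\<close>

context diagonal_left_regular_magma
begin

text \<open>
  All permutations of \<open>M\<close> are extended by the identity outside \<open>M\<close>, so that they become
  bijections of the whole type and can be inverted and composed freely.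
\<close>

definition lmul :: "'a \<Rightarrow> 'a \<Rightarrow> 'a" where
  "lmul x b = (if x \<in> M \<and> b \<in> M then x \<rhd> b else b)"

text \<open>The map \<Lambda>, extended by the identity outside \<open>M\<close>.\<close>

definition diag :: "'a \<Rightarrow> 'a" where
  "diag x = Hilbert_Choice.inv (lmul x) x"

lemma bij_lmul: "bij (lmul x)" and lmul_image: "lmul x ` M = M"
proof -
  have M: "bij_betw (lmul x) M M"
  proof (cases "x \<in> M")
    case True
    then show ?thesis
      using left_regular[OF True] by (simp add: lmul_def cong: bij_betw_cong)
  qed (simp add: lmul_def bij_betw_def inj_on_def)
  moreover have "bij_betw (lmul x) (- M) (- M)"
    by (auto simp: lmul_def bij_betw_def inj_on_def)
  ultimately show "bij (lmul x)"
    using bij_betw_combine[of "lmul x" M M "- M" "- M"] by simp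
  show "lmul x ` M = M"
    using M by (simp add: bij_betw_def)
qed

lemma bij_diag: "bij diag" and diag_image: "diag ` M = M"
proof -
  have "diag x = magma_Lambda M (\<rhd>) x" if "x \<in> M" for x
  proof -
    have "magma_Lambda M (\<rhd>) x \<in> M" "x \<rhd> magma_Lambda M (\<rhd>) x = x"
      using left_regular[OF that] that unfolding magma_Lambda_def bij_betw_def
      by (metis inv_into_into, metis f_inv_into_f)
    then have "lmul x (magma_Lambda M (\<rhd>) x) = x"
      using that by (simp add: lmul_def)
    then show ?thesis
      unfolding diag_def by (metis bij_inv_eq_iff bij_lmul)
  qed
  then have M: "bij_betw diag M M"
    using diagonal by (simp cong: bij_betw_cong)
  have "diag x = x" if "x \<notin> M" for x
  proof -
    have "lmul x = id" using that by (auto simp: lmul_def)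
    then show ?thesis by (simp add: diag_def)
  qed
  then have "bij_betw diag (- M) (- M)"
    by (auto simp: bij_betw_def inj_on_def image_iff)
  with M show "bij diag"
    using bij_betw_combine[of diag M M "- M" "- M"] by simp
  show "diag ` M = M"
    using M by (simp add: bij_betw_def)
qed

section \<open>Action of letters and words on the generators\<close>

definition letter_perm :: "'a \<times> bool \<Rightarrow> 'a \<Rightarrow> 'a" where
  "letter_perm l = (if snd l then lmul (fst l)
     else Hilbert_Choice.inv (lmul (Hilbert_Choice.inv diag (fst l))))"

lemma bij_letter_perm: "bij (letter_perm l)"
  by (simp add: letter_perm_def bij_lmul bij_imp_bij_inv)

lemma inv_lmul_image: "Hilbert_Choice.inv (lmul x) ` M = M"
  using image_inv_f_f[OF bij_is_inj[OF bij_lmul]] lmul_image by metis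

lemma letter_perm_image: "letter_perm l ` M = M"
  by (simp add: letter_perm_def lmul_image inv_lmul_image)

lemma inv_letter_perm_image: "Hilbert_Choice.inv (letter_perm l) ` M = M"
  using image_inv_f_f[OF bij_is_inj[OF bij_letter_perm]] letter_perm_image by metis

text \<open>The letter on the left is the \<open>*\<close>-inverse of \<open>(x, e)\<close>: acting
  on it by \<open>(x, e)\<close> yields the formal inverse of \<open>(x, e)\<close>. Both cases
  reduce to the defining equation of \<Lambda>.\<close>

lemma letter_perm_inverse:
  "letter_perm (Hilbert_Choice.inv (letter_perm (x, e)) x, \<not> e) =
     Hilbert_Choice.inv (letter_perm (x, e))"
proof (cases e)
  case True
  then show ?thesis
    using bij_diag by (simp add: letter_perm_def bij_is_inj flip: diag_def)
next
  case False
  define y where "y = Hilbert_Choice.inv diag x"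
  have "diag y = x"
    unfolding y_def using bij_diag by (simp add: bij_is_surj surj_f_inv_f)
  then have "lmul y x = y"
    unfolding diag_def by (metis bij_inv_eq_iff bij_lmul)
  then show ?thesis
    using False by (simp add: letter_perm_def inv_inv_eq bij_lmul flip: y_def)
qed

text \<open>The recursive call is on a relabelled tail, so the recursion is on length rather than
  structural. Unreduced words are allowed as well.\<close>

function word_perm :: "('a \<times> bool) list \<Rightarrow> 'a \<Rightarrow> 'a" where
  "word_perm [] = id"
| "word_perm (l # u) =
     letter_perm l \<circ> word_perm (relabel (Hilbert_Choice.inv (letter_perm l)) u)"
  by pat_completeness auto
termination by (relation "measure length") auto

lemma bij_word_perm: "bij (word_perm w)"
  by (induction w rule: word_perm.induct)
    (simp_all only: word_perm.simps bij_id bij_comp bij_letter_perm)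

lemma word_perm_image: "word_perm w ` M = M"
  by (induction w rule: word_perm.induct)
    (simp_all only: word_perm.simps image_id image_ident id_apply image_comp[symmetric] letter_perm_image)

text \<open>The right side is \<open>word_perm (l # w)\<close>, so this is invariance under
  cancelling a leading pair. By \<open>letter_perm_inverse\<close>, the relabelled second letter
  acts inversely to the first, and the two relabellings of the rest undo each other.\<close>

lemma word_perm_cons_reduce:
  "word_perm (cons_reduce l w) =
     letter_perm l \<circ> word_perm (relabel (Hilbert_Choice.inv (letter_perm l)) w)"
proof (cases w)
  case (Cons k v)
  show ?thesis
  proof (cases "fst l = fst k \<and> snd l \<noteq> snd k")
    case True
    obtain x e where l: "l = (x, e)" by (cases l)
    with True have k: "k = (x, \<not> e)" by (cases k) auto
    let ?p = "letter_perm (x, e)"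
    have p: "?p \<circ> Hilbert_Choice.inv ?p = id"
      using bij_letter_perm by (simp add: bij_is_surj surj_iff[THEN iffD1])
    have "letter_perm l \<circ> word_perm (relabel (Hilbert_Choice.inv (letter_perm l)) w) =
        ?p \<circ> (Hilbert_Choice.inv ?p \<circ> word_perm (relabel ?p (relabel (Hilbert_Choice.inv ?p) v)))"
      by (simp add: Cons l k letter_perm_inverse inv_inv_eq bij_letter_perm)
    also have "\<dots> = word_perm v"
      by (simp add: relabel_relabel p relabel_id flip: comp_assoc)
    finally show ?thesis
      by (simp add: Cons l k)
  qed (use Cons in auto)
qed simp

lemma word_perm_mult:
  "word_perm (foldr cons_reduce a (relabel (word_perm a) b)) = word_perm a \<circ> word_perm b"
proof (induction a rule: word_perm.induct)
  case (2 l u)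
  let ?i = "Hilbert_Choice.inv (letter_perm l)"
  have i: "inj ?i" "?i \<circ> letter_perm l = id"
    using bij_letter_perm by (simp_all add: bij_imp_bij_inv bij_is_inj)
  \<comment> \<open>Moving \<open>?i\<close> inside turns the product into
    \<open>relabel ?i u * b\<close>, to which the induction hypothesis applies.\<close>
  have "relabel ?i (foldr cons_reduce u (relabel (word_perm (l # u)) b)) =
      foldr cons_reduce (relabel ?i u) (relabel (word_perm (relabel ?i u)) b)"
    by (simp add: relabel_foldr_cons_reduce i relabel_relabel flip: comp_assoc)
  moreover have "word_perm (foldr cons_reduce (l # u) v) =
      letter_perm l \<circ> word_perm (relabel ?i (foldr cons_reduce u v))" for v
    by (simp add: word_perm_cons_reduce)
  ultimately show ?case
    by (simp only: 2 word_perm.simps(2) comp_assoc)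
qed (simp add: relabel_id[unfolded id_def])

section \<open>The extended product\<close>

definition free_post :: "('a \<times> bool) list \<Rightarrow> ('a \<times> bool) list \<Rightarrow> ('a \<times> bool) list" where
  "free_post = (\<lambda>a\<in>carrier (free_group M). \<lambda>b\<in>carrier (free_group M). relabel (word_perm a) b)"

lemma free_post_eq:
  "\<lbrakk>a \<in> carrier (free_group M); b \<in> carrier (free_group M)\<rbrakk> \<Longrightarrow>
     free_post a b = relabel (word_perm a) b"
  by (simp add: free_post_def)

lemma relabel_word_perm_closed:
  "b \<in> carrier (free_group M) \<Longrightarrow> relabel (word_perm a) b \<in> carrier (free_group M)"
  by (intro relabel_closed) (simp_all add: bij_word_perm bij_is_inj word_perm_image)

lemma free_post_incl: "\<lbrakk>a \<in> M; b \<in> M\<rbrakk> \<Longrightarrow> free_post (free_incl a) (free_incl b) = free_incl (a \<rhd> b)"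
  by (simp add: free_post_eq free_incl_closed) (simp add: free_incl_def letter_perm_def lmul_def)

lemma post_group_free_post: "post_group (free_group M) free_post"
proof -
  interpret F: group "free_group M" by (rule group_free_group)
  show ?thesis
  proof
    fix a assume a: "a \<in> carrier (free_group M)"
    show "free_post a \<in> iso (free_group M) (free_group M)"
      by (rule F.iso_eq[OF relabel_iso[OF bij_word_perm word_perm_image]])
        (simp add: free_post_eq a)
    fix b c assume bc: "b \<in> carrier (free_group M)" "c \<in> carrier (free_group M)"
    show "free_post (a \<otimes>\<^bsub>free_group M\<^esub> free_post a b) c = free_post a (free_post b c)"
    proof -
      have "a \<otimes>\<^bsub>free_group M\<^esub> relabel (word_perm a) b \<in> carrier (free_group M)"
        using a bc by (simp add: relabel_word_perm_closed)
      moreover have "word_perm (a \<otimes>\<^bsub>free_group M\<^esub> relabel (word_perm a) b) =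
          word_perm a \<circ> word_perm b"
        by (simp add: free_group_def word_perm_mult)
      ultimately show ?thesis
        using a bc by (simp add: free_post_eq relabel_word_perm_closed relabel_relabel)
    qed
  qed
qed

lemma post_group_extension_free_post: "post_group_extension M (\<rhd>) free_post"
  unfolding post_group_extension_def
  using post_group_free_post free_post_incl
  by (auto simp: free_post_def relabel_word_perm_closed)

section \<open>Morphisms out of the free post-group\<close>

lemma post_group_hom_free_post:
  assumes "post_group G q" and h: "h \<in> hom (free_group M) G"
    and gen: "\<And>a b. \<lbrakk>a \<in> M; b \<in> M\<rbrakk> \<Longrightarrow>
      h (free_incl (a \<rhd> b)) = q (h (free_incl a)) (h (free_incl b))"
  shows "h \<in> post_group_hom (free_group M) free_post G q"
proof -
  interpret G: post_group G q by fact
  interpret F: post_group "free_group M" free_post by (rule post_group_free_post)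
  interpret h: group_hom "free_group M" G h by unfold_locales (rule h)
  let ?C = "carrier (free_group M)"
  \<comment> \<open>The elements whose action \<open>h\<close> respects are closed under
    \<open>*\<close>.\<close>
  have mult: "h (free_post (a \<otimes>\<^bsub>free_group M\<^esub> free_post a a') b) =
      q (h (a \<otimes>\<^bsub>free_group M\<^esub> free_post a a')) (h b)"
    if "a \<in> ?C" "a' \<in> ?C" "b \<in> ?C"
      and 1: "\<And>b. b \<in> ?C \<Longrightarrow> h (free_post a b) = q (h a) (h b)"
      and 2: "\<And>b. b \<in> ?C \<Longrightarrow> h (free_post a' b) = q (h a') (h b)" for a a' b
    using that by (simp add: F.post_mult F.post_closed G.post_mult)
  \<comment> \<open>Both sides are group morphisms in \<open>b\<close> that agree on
    generators.\<close>
  have pos: "h (free_post (free_incl x) b) = q (h (free_incl x)) (h b)"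
    if x: "x \<in> M" and b: "b \<in> ?C" for x b
  proof -
    have "h \<circ> free_post (free_incl x) \<in> hom (free_group M) G"
      by (rule hom_compose[OF F.post_hom[OF free_incl_closed[OF x]] h])
    moreover have "q (h (free_incl x)) \<circ> h \<in> hom (free_group M) G"
      by (rule hom_compose[OF h G.post_hom[OF h.hom_closed[OF free_incl_closed[OF x]]]])
    ultimately have "(h \<circ> free_post (free_incl x)) b = (q (h (free_incl x)) \<circ> h) b"
      by (rule free_group_hom_eqI[OF G.is_group _ _ _ b]) (simp add: free_post_incl gen x)
    then show ?thesis by simp
  qed
  \<comment> \<open>With \<open>y\<close> the preimage of \<open>x\<close> under \<Lambda>, the
    formal inverse of \<open>x\<close> is the \<open>*\<close>-inverse of \<open>y\<close>. Both
    sides become \<open>h b\<close> under the injective action of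
    \<open>h (free_incl y)\<close>.\<close>
  have neg: "h (free_post [(x, False)] b) = q (h [(x, False)]) (h b)"
    if x: "x \<in> M" and b: "b \<in> ?C" for x b
  proof -
    define y where "y = Hilbert_Choice.inv diag x"
    have y: "y \<in> M"
      unfolding y_def using x diag_image bij_diag by (metis bij_is_inj image_inv_f_f imageI)
    have "diag y = x"
      unfolding y_def using bij_diag by (simp add: bij_is_surj surj_f_inv_f)
    then have "lmul y x = y"
      unfolding diag_def by (metis bij_inv_eq_iff bij_lmul)
    then have "free_post (free_incl y) [(x, False)] = [(y, False)]"
      using x y by (simp add: free_post_def free_incl_def free_group_def letter_perm_def)
    then have star: "free_incl y \<otimes>\<^bsub>free_group M\<^esub> free_post (free_incl y) [(x, False)] =
        \<one>\<^bsub>free_group M\<^esub>"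
      by (simp add: free_incl_def free_group_def)
    have C: "[(x, False)] \<in> ?C" "free_incl y \<in> ?C"
      using x y by (simp_all add: free_group_def free_incl_def)
    have "q (h (free_incl y)) (h (free_post [(x, False)] b)) = h b"
      using b C y by (simp add: star F.post_one_left F.post_closed flip: pos F.post_mult)
    also have "h b = q (h (free_incl y \<otimes>\<^bsub>free_group M\<^esub> free_post (free_incl y) [(x, False)])) (h b)"
      using b by (simp add: star G.post_one_left)
    also have "\<dots> = q (h (free_incl y)) (q (h [(x, False)]) (h b))"
      using b C y by (simp add: F.post_closed pos G.post_mult)
    finally show ?thesis
      by (rule G.post_inj[rotated 3]) (use b C in \<open>simp_all add: F.post_closed G.post_closed\<close>)
  qed
  \<comment> \<open>Induction along \<open>word_perm\<close> supplies the hypothesis for the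
    relabelled tail \<open>?u\<close> instead of \<open>u\<close>.\<close>
  have "\<forall>b\<in>?C. h (free_post a b) = q (h a) (h b)" if "a \<in> ?C" for a
    using that
  proof (induction a rule: word_perm.induct)
    case 1
    have "\<one>\<^bsub>free_group M\<^esub> = []" by (simp add: free_group_def)
    then show ?case
      using F.post_one_left h.hom_one by (simp add: G.post_one_left)
  next
    case (2 l u)
    let ?u = "relabel (Hilbert_Choice.inv (letter_perm l)) u"
    have l: "[l] \<in> ?C" and u: "u \<in> ?C"
      using 2(2) by (auto simp: free_group_def dest: reduced_tl)
    have u': "?u \<in> ?C"
      using u bij_letter_perm inv_letter_perm_image
      by (intro relabel_closed) (auto simp: bij_imp_bij_inv bij_is_inj)
    have letter: "h (free_post [l] b) = q (h [l]) (h b)" if "b \<in> ?C" for b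
      using l that pos[of "fst l" b] neg[of "fst l" b]
      by (cases l; cases "snd l") (auto simp: free_group_def free_incl_def)
    \<comment> \<open>Hence \<open>l # u\<close> is \<open>[l] * ?u\<close>, and \<open>mult\<close>
      applies.\<close>
    have "free_post [l] ?u = u"
      using l u' bij_letter_perm
      by (simp add: free_post_eq relabel_relabel relabel_id bij_is_surj surj_iff[THEN iffD1])
    moreover have "[l] \<otimes>\<^bsub>free_group M\<^esub> u = l # u"
      using 2(2) by (cases u) (auto simp: free_group_def)
    ultimately show ?case
      using mult[OF l u' _ letter] 2(1)[OF u'] by metis
  qed
  then show ?thesis
    using h by (simp add: post_group_hom_def)
qed

lemma post_group_extension_unique:
  assumes p: "post_group_extension M (\<rhd>) p"
  shows "p = free_post"
proof -
  \<comment> \<open>The condition on generators holds because \<open>p\<close> extends the product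
    of \<open>M\<close>.\<close>
  have "(\<lambda>a. a) \<in> post_group_hom (free_group M) free_post (free_group M) p"
    using p by (intro post_group_hom_free_post) (auto simp: post_group_extension_def hom_def)
  then have eq: "free_post a b = p a b"
    if "a \<in> carrier (free_group M)" "b \<in> carrier (free_group M)" for a b
    using that by (simp add: post_group_hom_def)
  have ext: "p \<in> carrier (free_group M) \<rightarrow>\<^sub>E carrier (free_group M) \<rightarrow>\<^sub>E carrier (free_group M)"
    "free_post \<in> carrier (free_group M) \<rightarrow>\<^sub>E carrier (free_group M) \<rightarrow>\<^sub>E carrier (free_group M)"
    using p post_group_extension_free_post by (simp_all add: post_group_extension_def)
  show ?thesis
  proof (rule PiE_ext[OF ext])
    fix a assume "a \<in> carrier (free_group M)"
    then show "p a = free_post a"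
      using ext eq by (intro PiE_ext[of _ "carrier (free_group M)" "\<lambda>_. carrier (free_group M)"]) auto
  qed
qed

text \<open>Among maps with values \<open>\<phi>\<close> on generators, post-group morphisms and
  group morphisms coincide, so the universal property of the free group carries over.\<close>

lemma free_post_universal:
  assumes G: "post_group G q" and \<phi>: "\<phi> \<in> magma_hom M (\<rhd>) (carrier G) q"
  shows "\<exists>!\<Phi>. \<Phi> \<in> post_group_hom (free_group M) free_post G q \<and>
    \<Phi> \<in> extensional (carrier (free_group M)) \<and> (\<forall>m\<in>M. \<Phi> (free_incl m) = \<phi> m)"
proof -
  have "h (free_incl (a \<rhd> b)) = q (h (free_incl a)) (h (free_incl b))"
    if "a \<in> M" "b \<in> M" "\<forall>m\<in>M. h (free_incl m) = \<phi> m" for h a b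
    using that \<phi> op_closed by (simp add: magma_hom_def)
  then have "\<Phi> \<in> post_group_hom (free_group M) free_post G q \<longleftrightarrow> \<Phi> \<in> hom (free_group M) G"
    if "\<forall>m\<in>M. \<Phi> (free_incl m) = \<phi> m" for \<Phi>
    using post_group_hom_free_post[OF G, of \<Phi>] that by (auto simp: post_group_hom_def)
  then have eq: "(\<Phi> \<in> post_group_hom (free_group M) free_post G q \<and>
      \<Phi> \<in> extensional (carrier (free_group M)) \<and> (\<forall>m\<in>M. \<Phi> (free_incl m) = \<phi> m)) \<longleftrightarrow>
    (\<Phi> \<in> hom (free_group M) G \<and>
      \<Phi> \<in> extensional (carrier (free_group M)) \<and> (\<forall>m\<in>M. \<Phi> (free_incl m) = \<phi> m))" for \<Phi>
    by blast
  have "\<phi> \<in> M \<rightarrow> carrier G" "group G"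
    using \<phi> G by (auto simp: magma_hom_def post_group_def)
  then show ?thesis
    unfolding eq by (intro free_group_universal)
qed

end

theorem theorem12:
  fixes M :: "'a set" and op :: "'a \<Rightarrow> 'a \<Rightarrow> 'a"
  assumes "diagonal_left_regular_magma M op"
  shows "(\<exists>!p. post_group_extension M op p) \<and>
    (\<forall>p. post_group_extension M op p \<longrightarrow>
      (\<forall>(G :: 'g monoid) q \<phi>. post_group G q \<and> \<phi> \<in> magma_hom M op (carrier G) q \<longrightarrow>
        (\<exists>!\<Phi>. \<Phi> \<in> post_group_hom (free_group M) p G q \<and>
              \<Phi> \<in> extensional (carrier (free_group M)) \<and>
              (\<forall>m\<in>M. \<Phi> (free_incl m) = \<phi> m))))"
proof -
  interpret diagonal_left_regular_magma M op by fact
  \<comment> \<open>Any extension equals \<open>free_post\<close>, so its universal property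
    suffices.\<close>
  show ?thesis
    using post_group_extension_free_post post_group_extension_unique free_post_universal by blast
qed

end
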